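(* In the transductive online matrix completion problem with trace-norm bound $B$ and convex $\rho$-Lipschitz loss, consider the predictions $$\hat y_t=B\,\mathbb E_\epsilon\Big[\Big\|\sum_{i=t+1}^T\epsilon_ix_i-\frac1{2\rho}\sum_{i=1}^{t-1}\partial\ell(\hat y_i,y_i)x_i+\frac12x_t\Big\|_\sigma-\Big\|\sum_{i=t+1}^T\epsilon_ix_i-\frac1{2\rho}\sum_{i=1}^{t-1}\partial\ell(\hat y_i,y_i)x_i-\frac12x_t\Big\|_\sigma\Big].$$ Then the regret is bounded as $$\mathbf{Reg}_T\le O\big(B\rho(\sqrt m+\sqrt n)\big).$$
   Context: Setting: a sequence of entry locations of an $m\times n$ matrix is known in advance, and only the entry values are unknown; $x_t\in\mathbb R^{m\times n}$ is the matrix with a $1$ at the $t$-th location and $0$ elsewhere ($t=1,\dots,T$). On round $t$ the learner makes a prediction $\hat y_t$ for the entry at location $x_t$, the adversary chooses its value $y_t$, and the learner suffers $\ell(\hat y_t,y_t)$, where $\ell$ is convex and $\rho$-Lipschitz in the prediction; $\partial\ell(\hat y_i,y_i)$ is a subgradient of $\ell(\cdot,y_i)$ at $\hat y_i$, so $|\partial\ell(\hat y_i,y_i)|\le\rho$. $\|\cdot\|_\Sigma$ is the trace (nuclear) norm, $\|\cdot\|_\sigma$ the spectral norm, $\langle f,x\rangle=\mathrm{tr}(f^\top x)$. $\mathbf{Reg}_T=\sum_{t=1}^T\ell(\hat y_t,y_t)-\inf_{f\in\mathbb R^{m\times n}:\|f\|_\Sigma\le B}\sum_{t=1}^T\ell(\langle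 f,x_t\rangle,y_t)$. The $\epsilon$'s are i.i.d. Rademacher variables.
   Formalization: The entry locations are assumed pairwise distinct (each matrix entry is revealed at most once); with repeated locations the bound fails, e.g. a 1×1 matrix with absolute loss and the same entry every round forces regret of order √T. *)

theory Defs
  imports
    "HOL-Probability.Product_PMF"
    "HOL-Analysis.Lipschitz"
    "Jordan_Normal_Form.Spectral_Radius"
begin

text \<open>
  Matrices are Jordan_Normal_Form matrices, whose dimensions are ordinary naturals, so that a
  constant can be chosen uniformly in the dimensions. Their indices start at 0.
\<close>

definition mat_inner :: "real mat \<Rightarrow> real mat \<Rightarrow> real" where
  \<comment> \<open>the trace of the product of the transpose of \<open>A\<close> with \<open>B\<close>\<close>
  "mat_inner A B = (\<Sum>j<dim_col A. (transpose_mat A * B) $$ (j, j))"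

definition l2_norm :: "real Matrix.vec \<Rightarrow> real" where
  "l2_norm v = sqrt (v \<bullet> v)"

definition spectral_norm :: "real mat \<Rightarrow> real" where
  "spectral_norm A = (SUP v\<in>{v \<in> carrier_vec (dim_col A). l2_norm v = 1}. l2_norm (A *\<^sub>v v))"

text \<open>
  The trace norm is the sum of the singular values, which are the square roots of the eigenvalues of
  the Gram matrix, each repeated according to its algebraic multiplicity.
\<close>

definition trace_norm :: "real mat \<Rightarrow> real" where
  "trace_norm A = (let G = transpose_mat A * A in
     \<Sum>z\<in>spectrum G. real (Polynomial.order z (char_poly G)) * sqrt z)"

definition entry_mat :: "nat \<Rightarrow> nat \<Rightarrow> nat \<times> nat \<Rightarrow> real mat" where
  "entry_mat m n p = Matrix.mat m n (\<lambda>q. if q = p then 1 else 0)"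

text \<open>
  Matrices of all sizes share one type, which therefore has no additive monoid structure; the size
  is needed to give a meaning to the empty sum.
\<close>

definition mat_lincomb ::
  "nat \<Rightarrow> nat \<Rightarrow> nat set \<Rightarrow> (nat \<Rightarrow> real) \<Rightarrow> (nat \<Rightarrow> real mat) \<Rightarrow> real mat" where
  "mat_lincomb m n I c X = Matrix.mat m n (\<lambda>q. \<Sum>i\<in>I. c i * X i $$ q)"

definition rademacher :: "nat set \<Rightarrow> (nat \<Rightarrow> real) pmf" where
  "rademacher I = Pi_pmf I 0 (\<lambda>_. pmf_of_set {-1, 1})"

definition is_subgradient :: "(real \<Rightarrow> real) \<Rightarrow> real \<Rightarrow> real \<Rightarrow> bool" where
  "is_subgradient f u s \<longleftrightarrow> (\<forall>v. f v \<ge> f u + s * (v - u))"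

text \<open>
  Here \<open>x i\<close> is the indicator matrix of the location of round \<open>i\<close> and \<open>g i\<close> is the subgradient of the
  loss of round \<open>i\<close>. Only the values of \<open>g\<close> on rounds before \<open>t\<close> are used.
\<close>

definition prediction ::
  "nat \<Rightarrow> nat \<Rightarrow> nat \<Rightarrow> (nat \<Rightarrow> real mat) \<Rightarrow> real \<Rightarrow> real \<Rightarrow> (nat \<Rightarrow> real) \<Rightarrow> nat \<Rightarrow> real" where
  "prediction m n T x B \<rho> g t =
     B * measure_pmf.expectation (rademacher {t+1..T}) (\<lambda>\<epsilon>.
       let M = mat_lincomb m n {t+1..T} \<epsilon> x - (1 / (2 * \<rho>)) \<cdot>\<^sub>m mat_lincomb m n {1..<t} g x
       in spectral_norm (M + (1/2) \<cdot>\<^sub>m x t) - spectral_norm (M - (1/2) \<cdot>\<^sub>m x t))"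

text \<open>
  The infimum is a real one: for \<open>B \<ge> 0\<close> the comparator class contains the zero matrix, and a
  Lipschitz loss is bounded below on it.
\<close>

definition regret ::
  "nat \<Rightarrow> nat \<Rightarrow> nat \<Rightarrow> (nat \<Rightarrow> real mat) \<Rightarrow> real \<Rightarrow> (real \<Rightarrow> real \<Rightarrow> real) \<Rightarrow>
   (nat \<Rightarrow> real) \<Rightarrow> (nat \<Rightarrow> real) \<Rightarrow> real" where
  "regret m n T x B loss yhat y =
     (\<Sum>t=1..T. loss (yhat t) (y t)) -
     (INF f\<in>{f \<in> carrier_mat m n. trace_norm f \<le> B}. \<Sum>t=1..T. loss (mat_inner f (x t)) (y t))"

end

theory Submission
  imports Defs
begin

text \<open>
  Linearising the losses by their subgradients and applying the duality of trace norm and spectral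
  norm bounds the regret by
  \<open>(\<Sum>t. g t * yhat t) + B * \<parallel>\<Sum>t. g t x t\<parallel>\<close>. Replacing, from the last round backwards, the
  term \<open>g t x t\<close> by \<open>2 \<rho> \<epsilon> t x t\<close> with a random sign never decreases this quantity, because the
  prediction cancels the linear part of a convex function of \<open>g t\<close>. What remains is \<open>2 \<rho> B\<close> times
  the expected spectral norm of a matrix with independent random signs in distinct positions. Its
  bilinear form is subgaussian, and rounding both arguments to integer points reduces the maximum
  over two spheres to a maximum over sets of size exponential in \<open>m\<close> and in \<open>n\<close>.
\<close>

subsection \<open>The spectral norm\<close>

lemma l2_norm_eq_L2_set: "l2_norm v = L2_set (\<lambda>i. v $ i) {..<dim_vec v}"
  unfolding l2_norm_def L2_set_def scalar_prod_def
  by (simp add: power2_eq_square lessThan_atLeast0)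

text \<open>Matrices and vectors are plain entry functions here, so that linearity in
  \<open>F\<close> and rounding of \<open>a\<close> and \<open>b\<close> involve no carrier
  conditions.\<close>

definition bilin :: "nat \<Rightarrow> nat \<Rightarrow> (nat \<times> nat \<Rightarrow> real) \<Rightarrow> (nat \<Rightarrow> real) \<Rightarrow> (nat \<Rightarrow> real) \<Rightarrow> real" where
  "bilin m n F a b = (\<Sum>i<m. \<Sum>j<n. a i * F (i, j) * b j)"

lemma bilin_lincomb:
  "bilin m n (\<lambda>q. p * F q + r * G q) a b = p * bilin m n F a b + r * bilin m n G a b"
  unfolding bilin_def by (simp add: algebra_simps sum.distrib sum_distrib_left)

lemma sum_mult_le_L2_set:
  fixes a c :: "'a \<Rightarrow> real"
  shows "(\<Sum>i\<in>A. a i * c i) \<le> L2_set a A * L2_set c A"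
proof -
  have "(\<Sum>i\<in>A. a i * c i) \<le> (\<Sum>i\<in>A. \<bar>a i\<bar> * \<bar>c i\<bar>)"
    by (intro sum_mono) (metis abs_ge_self abs_mult)
  also have "\<dots> \<le> L2_set a A * L2_set c A" by (rule L2_set_mult_ineq)
  finally show ?thesis .
qed

lemma l2_norm_mult_mat_vec:
  assumes "v \<in> carrier_vec n"
  shows "l2_norm (Matrix.mat m n F *\<^sub>v v) = L2_set (\<lambda>i. \<Sum>j<n. F (i, j) * v $ j) {..<m}"
proof -
  have "(Matrix.mat m n F *\<^sub>v v) $ i = (\<Sum>j<n. F (i, j) * v $ j)" if "i < m" for i
    using that assms by (simp add: scalar_prod_def lessThan_atLeast0)
  then show ?thesis
    unfolding l2_norm_eq_L2_set by (intro L2_set_cong) auto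
qed

text \<open>A real supremum dominates its members only if they are bounded. Coordinates of a unit
  vector have modulus at most 1, so the sum of the moduli of all entries of \<open>A\<close> is a
  bound.\<close>

lemma bdd_above_l2_norm_mult_mat_vec:
  "bdd_above ((\<lambda>v. l2_norm (A *\<^sub>v v)) ` {v \<in> carrier_vec (dim_col A). l2_norm v = 1})"
proof (rule bdd_aboveI2)
  fix v assume "v \<in> {v \<in> carrier_vec (dim_col A). l2_norm v = 1}"
  then have v: "v \<in> carrier_vec (dim_col A)" and "l2_norm v = 1" by auto
  then have v1: "L2_set (\<lambda>j. v $ j) {..<dim_col A} = 1"
    by (simp add: l2_norm_eq_L2_set)
  have comp: "\<bar>\<Sum>j<dim_col A. A $$ (i, j) * v $ j\<bar> \<le> (\<Sum>j<dim_col A. \<bar>A $$ (i, j)\<bar>)" for i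
  proof -
    have "\<bar>v $ j\<bar> \<le> 1" if "j < dim_col A" for j
      using member_le_L2_set[of "{..<dim_col A}" j "\<lambda>j. \<bar>v $ j\<bar>"] that v1
      by (simp add: L2_set_def)
    then have "(\<Sum>j<dim_col A. \<bar>A $$ (i, j) * v $ j\<bar>) \<le> (\<Sum>j<dim_col A. \<bar>A $$ (i, j)\<bar>)"
      by (intro sum_mono) (simp add: abs_mult mult_left_le)
    then show ?thesis by (rule order_trans[OF sum_abs])
  qed
  have A: "Matrix.mat (dim_row A) (dim_col A) (\<lambda>q. A $$ q) = A"
    by (intro eq_matI) auto
  have "l2_norm (A *\<^sub>v v) = L2_set (\<lambda>i. \<Sum>j<dim_col A. A $$ (i, j) * v $ j) {..<dim_row A}"
    using l2_norm_mult_mat_vec[OF v, of "dim_row A" "\<lambda>q. A $$ q"] A by simp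
  also have "\<dots> \<le> (\<Sum>i<dim_row A. \<bar>\<Sum>j<dim_col A. A $$ (i, j) * v $ j\<bar>)"
    by (rule L2_set_le_sum_abs)
  also have "\<dots> \<le> (\<Sum>i<dim_row A. \<Sum>j<dim_col A. \<bar>A $$ (i, j)\<bar>)"
    by (intro sum_mono comp)
  finally show "l2_norm (A *\<^sub>v v) \<le> (\<Sum>i<dim_row A. \<Sum>j<dim_col A. \<bar>A $$ (i, j)\<bar>)" .
qed

lemma l2_norm_smult: "l2_norm (c \<cdot>\<^sub>v v) = \<bar>c\<bar> * l2_norm v"
  unfolding l2_norm_eq_L2_set L2_set_def
  by (simp add: power_mult_distrib real_sqrt_mult flip: sum_distrib_left)

lemma l2_norm_nonneg [simp]: "l2_norm v \<ge> 0"
  by (simp add: l2_norm_eq_L2_set)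

lemma l2_norm_mult_le:
  assumes v: "v \<in> carrier_vec (dim_col A)"
  shows "l2_norm (A *\<^sub>v v) \<le> spectral_norm A * l2_norm v"
proof (cases "l2_norm v = 0")
  \<comment> \<open>A vector of norm 0 cannot be normalised. This case also covers matrices without
    columns, where \<open>spectral_norm\<close> is a supremum over the empty set.\<close>
  case True
  then have "v = 0\<^sub>v (dim_col A)"
    using v by (auto simp: l2_norm_eq_L2_set L2_set_eq_0_iff intro!: eq_vecI)
  moreover have "A *\<^sub>v 0\<^sub>v (dim_col A) = 0\<^sub>v (dim_row A)"
    by (intro eq_vecI) (auto simp: scalar_prod_def)
  ultimately show ?thesis by (simp add: l2_norm_def)
next
  case False
  define u where "u = (1 / l2_norm v) \<cdot>\<^sub>v v"
  have "l2_norm (A *\<^sub>v u) \<le> spectral_norm A"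
    unfolding spectral_norm_def
    by (rule cSUP_upper[OF _ bdd_above_l2_norm_mult_mat_vec])
       (use v False in \<open>simp add: u_def l2_norm_smult\<close>)
  moreover have "A *\<^sub>v u = (1 / l2_norm v) \<cdot>\<^sub>v (A *\<^sub>v v)"
    unfolding u_def using v by (intro mult_mat_vec) auto
  ultimately have "(1 / l2_norm v) * l2_norm (A *\<^sub>v v) \<le> spectral_norm A"
    by (simp add: l2_norm_smult)
  moreover have "l2_norm v > 0" using False by (simp add: less_le)
  ultimately show ?thesis by (simp add: field_simps)
qed

lemma spectral_norm_nonneg:
  assumes "dim_col A > 0"
  shows "spectral_norm A \<ge> 0"
proof -
  have "l2_norm (unit_vec (dim_col A) 0) = 1"
    using assms by (simp add: l2_norm_def)
  then have "l2_norm (A *\<^sub>v unit_vec (dim_col A) 0) \<le> spectral_norm A"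
    using l2_norm_mult_le[of "unit_vec (dim_col A) 0" A] by simp
  then show ?thesis by (rule order_trans[OF l2_norm_nonneg])
qed

lemma bilin_eq_sum: "bilin m n F a b = (\<Sum>i<m. a i * (\<Sum>j<n. F (i, j) * b j))"
  unfolding bilin_def by (simp add: sum_distrib_left mult.assoc)

text \<open>Cauchy-Schwarz for \<open>a\<close> against the image of \<open>b\<close>, then the
  operator bound for that image.\<close>

lemma bilin_le_spectral_norm:
  "bilin m n F a b \<le> spectral_norm (Matrix.mat m n F) * L2_set a {..<m} * L2_set b {..<n}"
proof -
  have "bilin m n F a b \<le> L2_set a {..<m} * L2_set (\<lambda>i. \<Sum>j<n. F (i, j) * b j) {..<m}"
    unfolding bilin_eq_sum by (rule sum_mult_le_L2_set)
  also have "\<dots> = L2_set a {..<m} *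
      l2_norm (Matrix.mat m n F *\<^sub>v Matrix.vec n b)"
    by (subst l2_norm_mult_mat_vec[of _ n]) (auto intro: L2_set_cong)
  also have "\<dots> \<le> L2_set a {..<m} * (spectral_norm (Matrix.mat m n F) * l2_norm (Matrix.vec n b))"
    by (intro mult_left_mono l2_norm_mult_le) auto
  also have "l2_norm (Matrix.vec n b) = L2_set b {..<n}"
    unfolding l2_norm_eq_L2_set by (intro L2_set_cong) auto
  finally show ?thesis by (simp add: mult_ac)
qed

text \<open>Converse of \<open>bilin_le_spectral_norm\<close>: the length of an image vector is its
  pairing with its own normalisation.\<close>

lemma spectral_norm_leI:
  assumes n: "n > 0"
    and le: "\<And>a b. L2_set a {..<m} \<le> 1 \<Longrightarrow> L2_set b {..<n} \<le> 1 \<Longrightarrow> bilin m n F a b \<le> K"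
  shows "spectral_norm (Matrix.mat m n F) \<le> K"
  unfolding spectral_norm_def
proof (rule cSUP_least)
  have "unit_vec n 0 \<in> {v \<in> carrier_vec (dim_col (Matrix.mat m n F)). l2_norm v = 1}"
    using n by (simp add: l2_norm_def)
  then show "{v \<in> carrier_vec (dim_col (Matrix.mat m n F)). l2_norm v = 1} \<noteq> {}" by blast
next
  fix v assume "v \<in> {v \<in> carrier_vec (dim_col (Matrix.mat m n F)). l2_norm v = 1}"
  then have v: "v \<in> carrier_vec n" and "l2_norm v = 1" by auto
  then have v1: "L2_set (\<lambda>j. v $ j) {..<n} \<le> 1" by (simp add: l2_norm_eq_L2_set)
  define c where "c i = (\<Sum>j<n. F (i, j) * v $ j)" for i
  define N where "N = L2_set c {..<m}"
  have N0: "N \<ge> 0" by (simp add: N_def)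
  \<comment> \<open>For \<open>N = 0\<close> the convention \<open>inverse 0 = 0\<close> makes the
    first argument zero, which still lies in the ball, and the bound then reads
    \<open>0 \<le> K\<close>.\<close>
  have "bilin m n F (\<lambda>i. inverse N * c i) (\<lambda>j. v $ j) \<le> K"
  proof (intro le v1)
    have "L2_set (\<lambda>i. inverse N * c i) {..<m} = inverse N * N"
      using N0 by (simp add: N_def flip: L2_set_right_distrib)
    then show "L2_set (\<lambda>i. inverse N * c i) {..<m} \<le> 1" by (cases "N = 0") auto
  qed
  also have "bilin m n F (\<lambda>i. inverse N * c i) (\<lambda>j. v $ j) = inverse N * (\<Sum>i<m. (c i)\<^sup>2)"
    unfolding bilin_eq_sum c_def[symmetric] by (simp add: sum_distrib_left power2_eq_square mult_ac)
  also have "(\<Sum>i<m. (c i)\<^sup>2) = N * N"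
    unfolding N_def L2_set_def by (simp add: sum_nonneg)
  finally have "inverse N * (N * N) \<le> K" .
  then have "N \<le> K" by (cases "N = 0") (auto simp: field_simps)
  then show "l2_norm (Matrix.mat m n F *\<^sub>v v) \<le> K"
    using v by (simp add: l2_norm_mult_mat_vec N_def c_def[abs_def])
qed

text \<open>For fixed arguments \<open>bilin\<close> is linear in the matrix; a supremum of linear
  functionals is sublinear.\<close>

lemma spectral_norm_lincomb_le:
  assumes n: "n > 0" and "p \<ge> 0" "r \<ge> 0"
  shows "spectral_norm (Matrix.mat m n (\<lambda>q. p * F q + r * G q)) \<le>
      p * spectral_norm (Matrix.mat m n F) + r * spectral_norm (Matrix.mat m n G)"
proof (rule spectral_norm_leI[OF n])
  fix a b :: "nat \<Rightarrow> real"
  assume ab: "L2_set a {..<m} \<le> 1" "L2_set b {..<n} \<le> 1"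
  have le: "bilin m n H a b \<le> spectral_norm (Matrix.mat m n H)" for H
  proof -
    have "spectral_norm (Matrix.mat m n H) * (L2_set a {..<m} * L2_set b {..<n}) \<le>
        spectral_norm (Matrix.mat m n H)"
      using ab n by (intro mult_left_le mult_le_one spectral_norm_nonneg) auto
    then show ?thesis using bilin_le_spectral_norm[of m n H a b] by (simp add: mult.assoc)
  qed
  show "bilin m n (\<lambda>q. p * F q + r * G q) a b \<le>
      p * spectral_norm (Matrix.mat m n F) + r * spectral_norm (Matrix.mat m n G)"
    unfolding bilin_lincomb using assms by (intro add_mono mult_left_mono le)
qed

subsection \<open>Duality of trace norm and spectral norm\<close>

text \<open>Over the complex numbers the characteristic polynomial splits; symmetry makes each root
  real, so the factorisation descends to real polynomials.\<close>

lemma real_symmetric_char_poly_splits: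
  fixes G :: "real mat"
  assumes G: "G \<in> carrier_mat n n" and sym: "transpose_mat G = G"
  shows "\<exists>es. char_poly G = (\<Prod>e\<leftarrow>es. [:- e, 1:])"
proof -
  define Gc where "Gc = map_mat complex_of_real G"
  have Gc: "Gc \<in> carrier_mat n n" using G by (simp add: Gc_def)
  have swap: "G $$ (i, j) = G $$ (j, i)" if "i < n" "j < n" for i j
    using that G sym by (metis carrier_matD index_transpose_mat(1))
  obtain as where as: "char_poly Gc = (\<Prod>a\<leftarrow>as. [:- a, 1:])"
    using char_poly_factorized[OF Gc] by blast
  have real: "a \<in> \<real>" if "a \<in> set as" for a
  proof -
    have "poly (char_poly Gc) a = 0"
      using that unfolding as by (rule linear_poly_root)
    then obtain v where "eigenvector Gc v a"
      using eigenvalue_root_char_poly[OF Gc] unfolding eigenvalue_def by blast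
    then have v: "v \<in> carrier_vec n" "v \<noteq> 0\<^sub>v n" and ev: "Gc *\<^sub>v v = a \<cdot>\<^sub>v v"
      using Gc unfolding eigenvector_def by auto
    \<comment> \<open>\<open>q\<close> is the Hermitian form of \<open>Gc\<close> at
      \<open>v\<close>. It equals \<open>a\<close> times the nonzero real \<open>r\<close>, and by
      symmetry it is its own conjugate.\<close>
    define q where "q = (\<Sum>i<n. \<Sum>j<n. cnj (v $ i) * (complex_of_real (G $$ (i, j)) * v $ j))"
    define r where "r = (\<Sum>i<n. (cmod (v $ i))\<^sup>2)"
    have comp: "(\<Sum>j<n. complex_of_real (G $$ (i, j)) * v $ j) = a * v $ i" if "i < n" for i
    proof -
      have "(Gc *\<^sub>v v) $ i = (a \<cdot>\<^sub>v v) $ i" using ev by simp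
      then show ?thesis using that v Gc G
        by (simp add: scalar_prod_def Gc_def lessThan_atLeast0)
    qed
    have "q = (\<Sum>i<n. cnj (v $ i) * (a * v $ i))"
      unfolding q_def by (intro sum.cong refl) (simp add: comp flip: sum_distrib_left)
    also have "\<dots> = a * complex_of_real r"
      unfolding r_def
      by (simp add: sum_distrib_left mult_ac flip: complex_norm_square)
    finally have q: "q = a * complex_of_real r" .
    have "cnj q = (\<Sum>i<n. \<Sum>j<n. v $ i * (complex_of_real (G $$ (i, j)) * cnj (v $ j)))"
      unfolding q_def by simp
    also have "\<dots> = (\<Sum>j<n. \<Sum>i<n. v $ i * (complex_of_real (G $$ (i, j)) * cnj (v $ j)))"
      by (rule sum.swap)
    also have "\<dots> = q"
      unfolding q_def by (intro sum.cong refl) (simp add: swap mult_ac)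
    finally have "cnj q = q" .
    moreover have "r \<noteq> 0"
    proof
      assume "r = 0"
      then have "\<forall>i<n. v $ i = 0" unfolding r_def by (simp add: sum_nonneg_eq_0_iff)
      then show False using v by auto
    qed
    ultimately have "cnj a = a" using q by simp
    then show ?thesis by (simp add: Reals_cnj_iff)
  qed
  define es where "es = map Re as"
  have as_es: "as = map complex_of_real es"
    unfolding es_def using real by (induction as) (auto simp: of_real_Re)
  \<comment> \<open>Embedding real polynomials into complex ones is injective, so it suffices to
    compare the images.\<close>
  interpret cp: map_poly_inj_idom_hom complex_of_real ..
  have "map_poly complex_of_real (char_poly G) = char_poly Gc"
    unfolding Gc_def by (rule of_real_hom.char_poly_hom[OF G, symmetric])
  also have "\<dots> = map_poly complex_of_real (\<Prod>e\<leftarrow>es. [:- e, 1:])"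
    unfolding as as_es
    by (induction es) (simp_all add: hom_distribs)
  finally show ?thesis by (auto dest: cp.injectivity)
qed

text \<open>Complete \<open>v\<close> to a basis, orthogonalise by Gram-Schmidt, which keeps the
  first vector, and normalise the columns.\<close>

lemma orthogonal_completion:
  fixes v :: "real Matrix.vec"
  assumes v: "v \<in> carrier_vec n" and unit: "v \<bullet> v = 1"
  obtains W where "W \<in> carrier_mat n n" "transpose_mat W * W = 1\<^sub>m n" "n > 0" "col W 0 = v"
proof -
  have v0: "v \<noteq> 0\<^sub>v n"
    using unit v by auto
  have n: "n > 0"
    using v0 v by (cases n) auto
  interpret cof_vec_space n "TYPE(real)" .
  define b where "b = basis_completion v"
  define ws where "ws = gram_schmidt n b"
  note bc = basis_completion[OF v v0, folded b_def]
  have ws: "set ws \<subseteq> carrier_vec n" "corthogonal ws" "length ws = n"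
    using gram_schmidt_result[OF bc(2) bc(4) bc(5) ws_def] bc(6) by auto
  obtain vs where "b = v # vs"
    using bc(6,7) n by (cases b) auto
  then have "hd ws = v"
    unfolding ws_def using gram_schmidt_hd[OF v] by simp
  then have ws0: "ws ! 0 = v"
    using ws(3) n by (metis hd_conv_nth length_0_conv less_numeral_extra(3))
  have wsc: "ws ! i \<in> carrier_vec n" if "i < n" for i
    using ws that by (metis nth_mem subset_eq)
  have orth: "ws ! i \<bullet> ws ! j = 0 \<longleftrightarrow> i \<noteq> j" if "i < n" "j < n" for i j
    using corthogonalD[OF ws(2)] that ws(3) by simp
  have pos: "ws ! i \<bullet> ws ! i > 0" if "i < n" for i
    using orth[OF that that] conjugate_square_ge_0_vec[of "ws ! i"] by (simp add: less_le)
  \<comment> \<open>Gram-Schmidt yields orthogonal nonzero vectors; scaling by \<open>s\<close>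
    makes them unit vectors and leaves \<open>v\<close>, which already is one.\<close>
  define s where "s i = 1 / sqrt (ws ! i \<bullet> ws ! i)" for i
  define W where "W = Matrix.mat n n (\<lambda>(i, j). s j * ws ! j $ i)"
  have col: "col W j = s j \<cdot>\<^sub>v ws ! j" if "j < n" for j
    using that wsc[OF that] unfolding W_def by (intro eq_vecI) auto
  have W: "W \<in> carrier_mat n n" unfolding W_def by simp
  moreover have "transpose_mat W * W = 1\<^sub>m n"
  proof (rule eq_matI)
    fix i j assume "i < dim_row (1\<^sub>m n :: real mat)" "j < dim_col (1\<^sub>m n :: real mat)"
    then have ij: "i < n" "j < n" by auto
    then have "(transpose_mat W * W) $$ (i, j) = s i * s j * (ws ! i \<bullet> ws ! j)"
      using W wsc[OF ij(1)] wsc[OF ij(2)]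
      by (simp add: col)
    also have "\<dots> = (if i = j then 1 else 0)"
      using orth[OF ij] pos[OF ij(1)] unfolding s_def by (auto simp: field_simps)
    finally show "(transpose_mat W * W) $$ (i, j) = 1\<^sub>m n $$ (i, j)"
      using ij by simp
  qed (use W in auto)
  moreover have "col W 0 = v"
    using col[OF n] v unit ws0 unfolding s_def by simp
  ultimately show ?thesis using n that by blast
qed

text \<open>
  Only the diagonal of the triangular form is needed; it already gives the lengths of the images of
  the columns of \<open>U\<close> under a matrix with Gram matrix \<open>A\<close>.
\<close>

lemma orthogonal_schur_diagonal:
  fixes A :: "real mat"
  assumes "A \<in> carrier_mat n n" and "char_poly A = (\<Prod>e\<leftarrow>es. [:- e, 1:])"
  shows "\<exists>U\<in>carrier_mat n n. transpose_mat U * U = 1\<^sub>m n \<and>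
           diag_mat (transpose_mat U * A * U) = es"
  using assms
proof (induction es arbitrary: n A)
  case Nil
  then have "n = 0"
    using degree_monic_char_poly[of A n] by auto
  then show ?case using Nil by (intro bexI[of _ "1\<^sub>m 0"]) (auto simp: diag_mat_def)
next
  case (Cons e es n A)
  note A = Cons.prems(1)
  have "eigenvalue A e"
    unfolding eigenvalue_root_char_poly[OF A] Cons.prems(2) by simp
  then obtain w where w: "w \<in> carrier_vec n" "w \<noteq> 0\<^sub>v n" and evw: "A *\<^sub>v w = e \<cdot>\<^sub>v w"
    using A unfolding eigenvalue_def eigenvector_def by auto
  have ww: "w \<bullet> w > 0"
    using conjugate_square_greater_0_vec[OF w(1)] w(2) by simp
  define v where "v = (1 / sqrt (w \<bullet> w)) \<cdot>\<^sub>v w"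
  have v: "v \<in> carrier_vec n" "v \<bullet> v = 1"
    using w ww by (auto simp: v_def)
  have ev: "A *\<^sub>v v = e \<cdot>\<^sub>v v"
    unfolding v_def mult_mat_vec[OF A w(1)] evw by (simp add: smult_smult_assoc mult.commute)
  obtain W where W: "W \<in> carrier_mat n n" and WW: "transpose_mat W * W = 1\<^sub>m n"
    and n: "n > 0" and W0: "col W 0 = v"
    using orthogonal_completion[OF v] by blast
  define A' where "A' = transpose_mat W * A * W"
  have A': "A' \<in> carrier_mat n n" using W A by (simp add: A'_def)
  have WW': "W * transpose_mat W = 1\<^sub>m n"
    using mat_mult_left_right_inverse[OF _ W WW] W by simp
  have sim: "similar_mat A' A"
    unfolding similar_mat_def
    by (intro exI, rule similar_mat_witI[of "transpose_mat W" W n])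
       (use W A A' WW WW' in \<open>auto simp: A'_def\<close>)
  \<comment> \<open>The first column of \<open>W\<close> is an eigenvector and the columns are
    orthonormal, so the first column of \<open>A'\<close> is \<open>e\<close> times the first unit
    vector.\<close>
  have col0: "A' $$ (i, 0) = (if i = 0 then e else 0)" if "i < n" for i
  proof -
    have "A' = transpose_mat W * (A * W)"
      unfolding A'_def using W A by (simp add: assoc_mult_mat[of _ n n])
    then have "A' $$ (i, 0) = col W i \<bullet> (A *\<^sub>v v)"
      using that n W A W0 by (simp add: mult_mat_vec_def)
    also have "\<dots> = e * (col W i \<bullet> col W 0)"
      unfolding ev W0 using W v by (simp add: scalar_prod_smult_distrib)
    also have "col W i \<bullet> col W 0 = (transpose_mat W * W) $$ (i, 0)"
      using that n W by simp
    finally show ?thesis unfolding WW using that n by simp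
  qed
  define k where "k = n - 1"
  have nk: "n = Suc k" using n by (simp add: k_def)
  obtain A1 A2 A0 A3 where split: "split_block A' 1 1 = (A1, A2, A0, A3)"
    by (cases "split_block A' 1 1") auto
  have dimA': "dim_row A' = 1 + k" "dim_col A' = 1 + k" using A' nk by auto
  note sb = split_block[OF split dimA']
  have A1: "A1 = Matrix.mat 1 1 (\<lambda>_. e)" and A0: "A0 = 0\<^sub>m k 1"
    using split col0 A' nk unfolding split_block_def Let_def
    by (auto intro!: eq_matI)
  have blk: "A' = four_block_mat A1 A2 A0 A3" by (rule sb(5))
  \<comment> \<open>Block triangularity factors the characteristic polynomial; cancelling the factor
    of \<open>e\<close> leaves that of the smaller block \<open>A3\<close> for the
    induction.\<close>
  have "char_poly A' = [:- e, 1:] * (\<Prod>e\<leftarrow>es. [:- e, 1:])"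
    using char_poly_similar[OF sim] Cons.prems(2) by simp
  moreover have "char_poly A' = char_poly A1 * char_poly A3"
    unfolding blk A0 by (rule char_poly_four_block_zeros_col[OF sb(1,2,4)])
  moreover have "char_poly A1 = [:- e, 1:]"
    by (simp add: A1 char_poly_defs det_def sign_def)
  ultimately have "char_poly A3 = (\<Prod>e\<leftarrow>es. [:- e, 1:])"
    by (metis mult_cancel_left pCons_eq_0_iff zero_neq_one)
  then obtain P where P: "P \<in> carrier_mat k k" and PP: "transpose_mat P * P = 1\<^sub>m k"
    and dP: "diag_mat (transpose_mat P * A3 * P) = es"
    using Cons.IH[OF sb(4)] by blast
  \<comment> \<open>Bordering \<open>P\<close> by a 1 makes the conjugation keep the corner entry
    \<open>e\<close> and put \<open>es\<close> on the rest of the diagonal.\<close>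
  define F where "F = four_block_mat (1\<^sub>m 1) (0\<^sub>m 1 k) (0\<^sub>m k 1) P"
  have F: "F \<in> carrier_mat n n" using P nk unfolding F_def by auto
  have FT: "transpose_mat F = four_block_mat (1\<^sub>m 1) (0\<^sub>m 1 k) (0\<^sub>m k 1) (transpose_mat P)"
    unfolding F_def using P by (subst transpose_four_block_mat) auto
  have FF: "transpose_mat F * F = 1\<^sub>m n"
    unfolding FT unfolding F_def using P PP nk
    by (subst mult_four_block_mat[of _ 1 1 _ k _ k]) auto
  have FAF: "transpose_mat F * A' * F =
      four_block_mat A1 (A2 * P) (0\<^sub>m k 1) (transpose_mat P * A3 * P)"
    unfolding FT unfolding F_def blk A0 using P sb A0
    by (subst mult_four_block_mat[of _ 1 1 _ k _ k], auto)
       (subst mult_four_block_mat[of _ 1 1 _ k _ k], auto)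
  have "transpose_mat (W * F) * (W * F) = transpose_mat F * (transpose_mat W * W) * F"
    using W F by (simp add: transpose_mult[of _ n n _ n] assoc_mult_mat[of _ n n _ n _ n])
  then have "transpose_mat (W * F) * (W * F) = 1\<^sub>m n"
    using F FF WW by simp
  moreover have "transpose_mat (W * F) * A * (W * F) = transpose_mat F * A' * F"
    using W F A by (simp add: A'_def transpose_mult[of _ n n _ n] assoc_mult_mat[of _ n n _ n _ n])
  then have "diag_mat (transpose_mat (W * F) * A * (W * F)) = e # es"
    using FAF P sb dP by (simp add: diag_four_block_mat[of _ 1 _ k]) (simp add: A1 diag_mat_def)
  ultimately show ?case using W F by (intro bexI[of _ "W * F"]) auto
qed

section \<open>Trace norm through an orthonormal basis\<close>

lemma trace_mult_commute:
  fixes X Y :: "'a :: comm_semiring_0 mat"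
  assumes "X \<in> carrier_mat n k" "Y \<in> carrier_mat k n"
  shows "(\<Sum>i<n. (X * Y) $$ (i, i)) = (\<Sum>i<k. (Y * X) $$ (i, i))"
proof -
  have "(\<Sum>i<n. (X * Y) $$ (i, i)) = (\<Sum>i<n. \<Sum>j<k. X $$ (i, j) * Y $$ (j, i))"
    using assms by (intro sum.cong) (auto simp: scalar_prod_def lessThan_atLeast0)
  also have "\<dots> = (\<Sum>j<k. \<Sum>i<n. Y $$ (j, i) * X $$ (i, j))"
    by (subst sum.swap) (simp add: mult.commute)
  also have "\<dots> = (\<Sum>i<k. (Y * X) $$ (i, i))"
    using assms by (intro sum.cong) (auto simp: scalar_prod_def lessThan_atLeast0)
  finally show ?thesis .
qed

text \<open>The \<open>order\<close> of a root is the number of its occurrences in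
  \<open>es\<close>, so the sum over the spectrum regroups into a sum over the list.\<close>

lemma trace_norm_eq_sum_list:
  assumes f: "f \<in> carrier_mat m n"
    and es: "char_poly (transpose_mat f * f) = (\<Prod>e\<leftarrow>es. [:- e, 1:])"
  shows "trace_norm f = sum_list (map sqrt es)"
proof -
  have G: "transpose_mat f * f \<in> carrier_mat n n" using f by simp
  have "spectrum (transpose_mat f * f) = set es"
    unfolding spectrum_root_char_poly[OF G] es
    by (auto simp: linear_poly_root poly_prod_list prod_list_zero_iff)
  moreover have "order z (\<Prod>e\<leftarrow>es. [:- e, 1:]) = count_list es z" for z :: real
  proof (induction es)
    case (Cons e es)
    have "(\<Prod>e\<leftarrow>es. [:- e, 1:]) \<noteq> 0"
      by (auto simp: prod_list_zero_iff)
    then show ?case using Cons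
      by (simp add: order_mult order_linear' del: mult_pCons_left)
  qed simp
  \<comment> \<open>The superset \<open>X\<close> stays fixed while the induction shortens the list;
    its further points have count 0.\<close>
  moreover have "(\<Sum>z\<in>X. real (count_list es z) * sqrt z) = sum_list (map sqrt es)"
    if "finite X" "set es \<subseteq> X" for X
    using that
  proof (induction es)
    case (Cons e es)
    have "(\<Sum>z\<in>X. real (count_list (e # es) z) * sqrt z) =
        (\<Sum>z\<in>X. (if z = e then sqrt z else 0) + real (count_list es z) * sqrt z)"
      by (intro sum.cong) (auto simp: algebra_simps)
    then show ?case using Cons by (simp add: sum.distrib)
  qed simp
  ultimately show ?thesis
    unfolding trace_norm_def Let_def es by simp
qed

text \<open>The trace is computed in the orthonormal basis of the columns of \<open>U\<close>. The
  diagonal of the conjugated Gram matrix holds the squared lengths of their images under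
  \<open>f\<close>, so these lengths are the square roots summed by \<open>trace_norm\<close>;
  Cauchy-Schwarz is applied to each column.\<close>

lemma mat_inner_le_trace_norm_spectral_norm:
  assumes f: "f \<in> carrier_mat m n" and A: "A \<in> carrier_mat m n"
  shows "mat_inner f A \<le> trace_norm f * spectral_norm A"
proof -
  define G where "G = transpose_mat f * f"
  have G: "G \<in> carrier_mat n n" using f by (simp add: G_def)
  have "transpose_mat G = G"
    using f unfolding G_def by (simp add: transpose_mult[of _ n m _ n])
  then obtain es where es: "char_poly G = (\<Prod>e\<leftarrow>es. [:- e, 1:])"
    using real_symmetric_char_poly_splits[OF G] by blast
  obtain U where U: "U \<in> carrier_mat n n" and UU: "transpose_mat U * U = 1\<^sub>m n"
    and dU: "diag_mat (transpose_mat U * G * U) = es"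
    using orthogonal_schur_diagonal[OF G es] by blast
  have UU': "U * transpose_mat U = 1\<^sub>m n"
    using mat_mult_left_right_inverse[OF _ U UU] U by simp
  have len: "length es = n"
    using dU U by (auto simp: diag_mat_def)
  have fU: "l2_norm (f *\<^sub>v col U j) = sqrt (es ! j)" if "j < n" for j
  proof -
    have "es ! j = (transpose_mat U * G * U) $$ (j, j)"
      using that U by (simp add: diag_mat_def flip: dU)
    also have "transpose_mat U * G * U = transpose_mat (f * U) * (f * U)"
      using U f unfolding G_def
      by (simp add: transpose_mult[of _ m n _ n] assoc_mult_mat[of _ n m _ n _ n]
          assoc_mult_mat[of _ n n _ m _ n] assoc_mult_mat[of _ n n _ n _ n]
          assoc_mult_mat[of _ n n _ m _ n])
    also have "\<dots> $$ (j, j) = (f *\<^sub>v col U j) \<bullet> (f *\<^sub>v col U j)"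
      using that U f by (simp add: col_mult2[of _ m n] mult_mat_vec_def)
    finally show ?thesis by (simp add: l2_norm_def)
  qed
  have AU: "l2_norm (A *\<^sub>v col U j) \<le> spectral_norm A" if "j < n" for j
  proof -
    have "col U j \<bullet> col U j = (transpose_mat U * U) $$ (j, j)"
      using that U by simp
    then have "l2_norm (col U j) = 1"
      using that by (simp add: UU l2_norm_def)
    then show ?thesis
      using l2_norm_mult_le[of "col U j" A] U A by auto
  qed
  define H where "H = transpose_mat f * A"
  have H: "H \<in> carrier_mat n n" using f A by (simp add: H_def)
  have HU: "(H * U) * transpose_mat U = H"
    using H U UU' by (simp add: assoc_mult_mat[of _ n n _ n _ n])
  have "mat_inner f A = (\<Sum>j<n. H $$ (j, j))"
    using f by (simp add: mat_inner_def H_def)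
  \<comment> \<open>Inserting \<open>U\<close> times its transpose lets cyclicity of the trace move
    the sum into the basis \<open>U\<close>.\<close>
  also have "\<dots> = (\<Sum>j<n. ((H * U) * transpose_mat U) $$ (j, j))"
    by (simp only: HU)
  also have "\<dots> = (\<Sum>j<n. (transpose_mat U * (H * U)) $$ (j, j))"
    by (rule trace_mult_commute) (use H U in auto)
  also have "transpose_mat U * (H * U) = transpose_mat (f * U) * (A * U)"
    unfolding H_def using U f A
    by (simp add: transpose_mult[of _ m n _ n] assoc_mult_mat[of _ n m _ n _ n]
          assoc_mult_mat[of _ n n _ m _ n])
  also have "(\<Sum>j<n. (transpose_mat (f * U) * (A * U)) $$ (j, j)) =
      (\<Sum>j<n. (f *\<^sub>v col U j) \<bullet> (A *\<^sub>v col U j))"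
    using U f A by (intro sum.cong) (auto simp: col_mult2[of _ m n] mult_mat_vec_def)
  also have "\<dots> \<le> (\<Sum>j<n. sqrt (es ! j) * spectral_norm A)"
  proof (rule sum_mono)
    fix j assume "j \<in> {..<n}"
    then have j: "j < n" by simp
    have "(f *\<^sub>v col U j) \<bullet> (A *\<^sub>v col U j) \<le> l2_norm (f *\<^sub>v col U j) * l2_norm (A *\<^sub>v col U j)"
      using sum_mult_le_L2_set[of "\<lambda>i. (f *\<^sub>v col U j) $ i" "\<lambda>i. (A *\<^sub>v col U j) $ i" "{..<m}"] f A
      by (simp add: l2_norm_eq_L2_set scalar_prod_def lessThan_atLeast0)
    also have "\<dots> \<le> l2_norm (f *\<^sub>v col U j) * spectral_norm A"
      by (intro mult_left_mono AU j) simp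
    finally show "(f *\<^sub>v col U j) \<bullet> (A *\<^sub>v col U j) \<le> sqrt (es ! j) * spectral_norm A"
      using fU[OF j] by simp
  qed
  also have "\<dots> = trace_norm f * spectral_norm A"
    using len trace_norm_eq_sum_list[OF f es[unfolded G_def]]
    by (simp add: sum_list_sum_nth sum_distrib_right lessThan_atLeast0)
  finally show ?thesis .
qed

subsection \<open>Random sign matrices\<close>

text \<open>With constant 1 instead of the sharp 1/2 in the exponent, elementary bounds suffice:
  quadratic ones up to 1, and \<open>x \<le> x\<^sup>2\<close> beyond.\<close>

lemma cosh_le_exp_square: "(exp x + exp (- x)) / 2 \<le> exp (x\<^sup>2)" for x :: real
proof -
  have *: "(exp x + exp (- x)) / 2 \<le> exp (x\<^sup>2)" if "x \<ge> 0" for x :: real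
  proof (cases "x \<le> 1")
    case True
    have "exp x \<le> 1 + x + x\<^sup>2" using that True by (rule exp_bound)
    moreover have "exp (- x) \<le> 1 - x + x\<^sup>2"
    proof -
      \<comment> \<open>The product is \<open>1 + x^3\<close>; together with
        \<open>1 + x \<le> exp x\<close> this bounds \<open>exp (- x)\<close>.\<close>
      have "1 \<le> (1 + x) * (1 - x + x\<^sup>2)"
        using that by (simp add: algebra_simps power2_eq_square)
      also have "\<dots> \<le> exp x * (1 - x + x\<^sup>2)"
        using True that by (intro mult_right_mono) (auto simp: exp_ge_add_one_self)
      finally show ?thesis by (simp add: exp_minus field_simps)
    qed
    ultimately have "(exp x + exp (- x)) / 2 \<le> 1 + x\<^sup>2" by simp
    then show ?thesis using exp_ge_add_one_self[of "x\<^sup>2"] by linarith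
  next
    case False
    then have "x \<le> x\<^sup>2" by (simp add: power2_eq_square)
    with that have "exp x \<le> exp (x\<^sup>2)" "exp (- x) \<le> exp (x\<^sup>2)" by simp_all
    from add_mono[OF this] show ?thesis by simp
  qed
  show ?thesis using *[of "\<bar>x\<bar>"] by (cases "x \<ge> 0") (auto simp: add.commute)
qed

section \<open>Exponential moments of Rademacher sums\<close>

lemma finite_set_pmf_rademacher [simp]: "finite I \<Longrightarrow> finite (set_pmf (rademacher I))"
  unfolding rademacher_def by (subst set_Pi_pmf) (auto intro!: finite_PiE_dflt)

lemma integrable_rademacher [simp, intro]:
  fixes h :: "(nat \<Rightarrow> real) \<Rightarrow> real"
  shows "finite I \<Longrightarrow> integrable (measure_pmf (rademacher I)) h"
  by (rule integrable_measure_pmf_finite) simp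

lemma expectation_rademacher_mono:
  fixes h k :: "(nat \<Rightarrow> real) \<Rightarrow> real"
  assumes "finite I" "\<And>\<epsilon>. h \<epsilon> \<le> k \<epsilon>"
  shows "measure_pmf.expectation (rademacher I) h \<le> measure_pmf.expectation (rademacher I) k"
  using assms by (intro Bochner_Integration.integral_mono) auto

text \<open>Independence turns the expectation into a product of hyperbolic cosines, each bounded by
  \<open>cosh_le_exp_square\<close>.\<close>

lemma expectation_rademacher_exp_le:
  assumes "finite I"
  shows "measure_pmf.expectation (rademacher I) (\<lambda>\<epsilon>. exp (\<Sum>t\<in>I. \<epsilon> t * c t)) \<le> exp (\<Sum>t\<in>I. (c t)\<^sup>2)"
proof -
  have "measure_pmf.expectation (rademacher I) (\<lambda>\<epsilon>. exp (\<Sum>t\<in>I. \<epsilon> t * c t)) =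
      (\<Prod>t\<in>I. measure_pmf.expectation (pmf_of_set {-1, 1}) (\<lambda>e. exp (e * c t)))"
    unfolding rademacher_def exp_sum[OF assms]
    by (rule expectation_prod_Pi_pmf[OF assms]) (auto intro: integrable_measure_pmf_finite)
  also have "\<dots> = (\<Prod>t\<in>I. (exp (c t) + exp (- c t)) / 2)"
    by (intro prod.cong refl) (simp add: integral_pmf_of_set add.commute)
  also have "\<dots> \<le> (\<Prod>t\<in>I. exp ((c t)\<^sup>2))"
    by (intro prod_mono conjI cosh_le_exp_square) (simp add: add_nonneg_nonneg)
  finally show ?thesis by (simp add: exp_sum[OF assms])
qed

text \<open>
  The points of the integer lattice of squared length at most \<open>4m\<close> take the place of an epsilon-net
  of the sphere of radius \<open>sqrt m\<close>: a linear form attains on this set at least its maximum over the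
  ball of radius \<open>sqrt m\<close>, since each coordinate can be rounded in the favourable direction.
\<close>

definition lattice_ball :: "nat \<Rightarrow> (nat \<Rightarrow> int) set" where
  "lattice_ball m = {z \<in> {..<m} \<rightarrow>\<^sub>E {- (4 * int m)..4 * int m}. (\<Sum>i<m. (z i)\<^sup>2) \<le> 4 * int m}"

lemma finite_lattice_ball [simp]: "finite (lattice_ball m)"
  unfolding lattice_ball_def by (auto intro!: finite_subset[OF _ finite_PiE[of "{..<m}" "\<lambda>_. {- (4 * int m)..4 * int m}"]])

text \<open>Comparison with a geometric series: the terms at \<open>k\<close> and \<open>- k\<close>
  are each at most \<open>(1/2) ^ k\<close>. The subtracted remainder of that series makes the
  induction close.\<close>

lemma sum_exp_neg_square_le: "(\<Sum>k\<in>{- int N..int N}. exp (- (real_of_int k)\<^sup>2)) \<le> 3 - 2 * (1/2) ^ N"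
proof (induction N)
  case (Suc N)
  have "{- int (Suc N)..int (Suc N)} =
      insert (- int (Suc N)) (insert (int (Suc N)) {- int N..int N})"
    by auto
  moreover have "(- 1 - real N)\<^sup>2 = (1 + real N)\<^sup>2"
    by (simp add: power2_eq_square algebra_simps)
  ultimately have "(\<Sum>k\<in>{- int (Suc N)..int (Suc N)}. exp (- (real_of_int k)\<^sup>2)) =
      2 * exp (- (real (Suc N))\<^sup>2) + (\<Sum>k\<in>{- int N..int N}. exp (- (real_of_int k)\<^sup>2))"
    by simp
  moreover have "exp (- (real (Suc N))\<^sup>2) \<le> (1/2) ^ Suc N"
  proof -
    have "real (Suc N) \<le> (real (Suc N))\<^sup>2"
      by (rule self_le_power) auto
    then have "exp (- (real (Suc N))\<^sup>2) \<le> exp (real (Suc N) * (-1))" by simp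
    also have "\<dots> = exp (-1) ^ Suc N" by (rule exp_of_nat_mult)
    also have "\<dots> \<le> (1/2) ^ Suc N"
      using exp_ge_add_one_self[of 1] by (intro power_mono) (auto simp: exp_minus field_simps)
    finally show ?thesis .
  qed
  ultimately show ?case using Suc by simp
qed simp

text \<open>Counting by weights: \<open>exp (4 * m)\<close> times a Gaussian product is at least 1
  on the ball, and its sum over the surrounding box factors into \<open>m\<close> one-dimensional
  sums, each at most 3 and so at most \<open>exp 2\<close>. Hence 6 = 4 + 2.\<close>

lemma card_lattice_ball_le: "real (card (lattice_ball m)) \<le> exp (6 * real m)"
proof -
  let ?P = "{..<m} \<rightarrow>\<^sub>E {- (4 * int m)..4 * int m}"
  have "real (card (lattice_ball m)) = (\<Sum>z\<in>lattice_ball m. 1)" by simp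
  also have "\<dots> \<le> (\<Sum>z\<in>lattice_ball m. exp (4 * real m) * (\<Prod>i<m. exp (- (real_of_int (z i))\<^sup>2)))"
  proof (rule sum_mono)
    fix z assume "z \<in> lattice_ball m"
    then have "real_of_int (\<Sum>i<m. (z i)\<^sup>2) \<le> real_of_int (4 * int m)"
      unfolding lattice_ball_def of_int_le_iff by simp
    then have "1 \<le> exp (4 * real m - (\<Sum>i<m. (real_of_int (z i))\<^sup>2))"
      by simp
    then show "1 \<le> exp (4 * real m) * (\<Prod>i<m. exp (- (real_of_int (z i))\<^sup>2))"
      by (simp add: sum_negf flip: exp_sum exp_add)
  qed
  also have "\<dots> \<le> (\<Sum>z\<in>?P. exp (4 * real m) * (\<Prod>i<m. exp (- (real_of_int (z i))\<^sup>2)))"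
  proof (rule sum_mono2)
    show "finite ?P" by (intro finite_PiE) simp_all
    show "lattice_ball m \<subseteq> ?P" unfolding lattice_ball_def by (rule Collect_restrict)
  qed (simp add: prod_nonneg)
  also have "\<dots> = exp (4 * real m) * (\<Prod>i<m. \<Sum>k\<in>{- (4 * int m)..4 * int m}. exp (- (real_of_int k)\<^sup>2))"
    unfolding sum_distrib_left[symmetric] by (subst prod_sum_PiE) simp_all
  also have "\<dots> \<le> exp (4 * real m) * (\<Prod>i<m. exp 2)"
  proof (intro mult_left_mono prod_mono conjI sum_nonneg)
    have "(0 :: real) \<le> (1/2) ^ (4 * m)" by (rule zero_le_power) simp
    then have "(\<Sum>k\<in>{- int (4 * m)..int (4 * m)}. exp (- (real_of_int k)\<^sup>2)) \<le> 3"
      using sum_exp_neg_square_le[of "4 * m"] by linarith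
    then have "(\<Sum>k\<in>{- (4 * int m)..4 * int m}. exp (- (real_of_int k)\<^sup>2)) \<le> 3" by simp
    also have "3 \<le> exp (2 :: real)" using exp_ge_add_one_self[of 2] by simp
    finally show "(\<Sum>k\<in>{- (4 * int m)..4 * int m}. exp (- (real_of_int k)\<^sup>2)) \<le> exp 2" .
  qed auto
  also have "\<dots> = exp (6 * real m)"
    by (simp add: mult.commute flip: exp_of_nat_mult exp_add)
  finally show ?thesis .
qed

lemma lattice_ball_rounding:
  fixes a c :: "nat \<Rightarrow> real"
  assumes "L2_set a {..<m} \<le> 1"
  shows "\<exists>z\<in>lattice_ball m. sqrt m * (\<Sum>i<m. a i * c i) \<le> (\<Sum>i<m. real_of_int (z i) * c i)"
proof -
  define s where "s i = sqrt m * a i" for i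
  define z where "z = (\<lambda>i\<in>{..<m}. if c i \<ge> 0 then \<lceil>s i\<rceil> else \<lfloor>s i\<rfloor>)"
  have z: "z i = (if c i \<ge> 0 then \<lceil>s i\<rceil> else \<lfloor>s i\<rfloor>)" if "i < m" for i
    using that by (simp add: z_def)
  have ub: "(\<Sum>i<m. (a i)\<^sup>2) \<le> 1"
    using assms unfolding L2_set_def by simp
  \<comment> \<open>Rounding moves a coordinate by at most 1. As the squares of \<open>s\<close> add
    up to at most \<open>m\<close>, summing this bound gives \<open>2 * m + 2 * m\<close>, the
    squared radius.\<close>
  have sq: "(real_of_int (z i))\<^sup>2 \<le> 2 * (s i)\<^sup>2 + 2" if "i < m" for i
  proof -
    have "\<bar>real_of_int (z i)\<bar> \<le> \<bar>s i\<bar> + 1"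
      unfolding z[OF that] by (auto split: if_splits) linarith+
    then have "(real_of_int (z i))\<^sup>2 \<le> (\<bar>s i\<bar> + 1)\<^sup>2"
      by (metis abs_ge_zero power2_abs power_mono)
    also have "\<dots> \<le> 2 * (s i)\<^sup>2 + 2"
      using zero_le_power2[of "\<bar>s i\<bar> - 1"] by (simp add: power2_sum power2_diff)
    finally show ?thesis .
  qed
  have "real_of_int (\<Sum>i<m. (z i)\<^sup>2) = (\<Sum>i<m. (real_of_int (z i))\<^sup>2)"
    by simp
  also have "\<dots> \<le> (\<Sum>i<m. 2 * (s i)\<^sup>2 + 2)"
    by (intro sum_mono sq) simp
  also have "\<dots> = 2 * real m * (\<Sum>i<m. (a i)\<^sup>2) + 2 * real m"
    by (simp add: s_def power_mult_distrib sum.distrib sum_distrib_left mult.assoc)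
  also have "\<dots> \<le> 2 * real m * 1 + 2 * real m"
    using ub by (intro add_right_mono mult_left_mono) auto
  finally have S: "(\<Sum>i<m. (z i)\<^sup>2) \<le> 4 * int m" by linarith
  \<comment> \<open>Membership in the box: an integer is in modulus at most its square, hence at
    most the whole sum of squares.\<close>
  have zb: "- (4 * int m) \<le> z i \<and> z i \<le> 4 * int m" if "i < m" for i
  proof -
    have "\<bar>z i\<bar> \<le> (z i)\<^sup>2"
    proof (cases "z i = 0")
      case False
      then have "1 \<le> \<bar>z i\<bar>" by linarith
      then show ?thesis using self_le_power[of "\<bar>z i\<bar>" 2] by simp
    qed simp
    also have "\<dots> \<le> (\<Sum>i<m. (z i)\<^sup>2)" using that by (intro member_le_sum) auto
    finally show ?thesis using S by linarith
  qed
  have ext: "z \<in> extensional {..<m}" by (simp add: z_def)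
  have "z \<in> lattice_ball m"
    using S zb unfolding lattice_ball_def PiE_iff by (auto simp: ext)
  moreover have "sqrt m * (\<Sum>i<m. a i * c i) \<le> (\<Sum>i<m. real_of_int (z i) * c i)"
    unfolding sum_distrib_left
  proof (rule sum_mono)
    fix i assume "i \<in> {..<m}"
    then have i: "i < m" by simp
    have "s i * c i \<le> real_of_int (z i) * c i"
    proof (cases "c i \<ge> 0")
      case True
      then show ?thesis using z[OF i] by (intro mult_right_mono) auto
    next
      case False
      then show ?thesis using z[OF i] by (intro mult_right_mono_neg) auto
    qed
    then show "sqrt m * (a i * c i) \<le> real_of_int (z i) * c i"
      by (simp add: s_def mult.assoc)
  qed
  ultimately show ?thesis by blast
qed

text \<open>One argument is rounded at a time: with the other fixed, the form is linear.\<close>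

lemma bilin_rounding:
  assumes a: "L2_set a {..<m} \<le> 1" and b: "L2_set b {..<n} \<le> 1"
  shows "\<exists>z\<in>lattice_ball m. \<exists>w\<in>lattice_ball n. sqrt m * sqrt n * bilin m n F a b \<le> bilin m n F z w"
proof -
  have swap: "bilin m n F u v = (\<Sum>j<n. v j * (\<Sum>i<m. u i * F (i, j)))" for u v
    unfolding bilin_def by (subst sum.swap) (simp add: sum_distrib_left mult_ac)
  obtain z where z: "z \<in> lattice_ball m" and "sqrt m * bilin m n F a b \<le> bilin m n F z b"
    using lattice_ball_rounding[OF a, of "\<lambda>i. \<Sum>j<n. F (i, j) * b j"]
    unfolding bilin_eq_sum by blast
  then have "sqrt n * (sqrt m * bilin m n F a b) \<le> sqrt n * bilin m n F z b"
    by (intro mult_left_mono) auto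
  moreover obtain w where w: "w \<in> lattice_ball n" and "sqrt n * bilin m n F z b \<le> bilin m n F z w"
    using lattice_ball_rounding[OF b, of "\<lambda>j. \<Sum>i<m. real_of_int (z i) * F (i, j)"]
    unfolding swap by blast
  ultimately have "sqrt m * sqrt n * bilin m n F a b \<le> bilin m n F z w"
    by (simp add: mult_ac)
  then show ?thesis using z w by blast
qed

section \<open>Expected spectral norm of a random sign matrix\<close>

definition sign_pattern :: "nat set \<Rightarrow> (nat \<Rightarrow> nat \<times> nat) \<Rightarrow> (nat \<Rightarrow> real) \<Rightarrow> nat \<times> nat \<Rightarrow> real" where
  "sign_pattern I loc \<epsilon> q = (\<Sum>t\<in>I. \<epsilon> t * (if loc t = q then 1 else 0))"

lemma bilin_sign_pattern:
  assumes "loc ` I \<subseteq> {..<m} \<times> {..<n}"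
  shows "bilin m n (sign_pattern I loc \<epsilon>) a b = (\<Sum>t\<in>I. \<epsilon> t * (a (fst (loc t)) * b (snd (loc t))))"
proof -
  have "bilin m n (sign_pattern I loc \<epsilon>) a b =
      (\<Sum>q\<in>{..<m} \<times> {..<n}. \<Sum>t\<in>I. if loc t = q then \<epsilon> t * (a (fst q) * b (snd q)) else 0)"
    unfolding bilin_def sign_pattern_def sum.cartesian_product'
    by (intro sum.cong refl) (auto simp: sum_distrib_left sum_distrib_right intro!: sum.cong)
  also have "\<dots> = (\<Sum>t\<in>I. \<Sum>q\<in>{..<m} \<times> {..<n}. if loc t = q then \<epsilon> t * (a (fst q) * b (snd q)) else 0)"
    by (rule sum.swap)
  also have "\<dots> = (\<Sum>t\<in>I. \<epsilon> t * (a (fst (loc t)) * b (snd (loc t))))"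
    using assms by (intro sum.cong refl) (simp add: image_subset_iff)
  finally show ?thesis .
qed

text \<open>At each pair of lattice points the bilinear form is a Rademacher sum with controlled
  exponential moment. The sum of the exponentials over all pairs dominates the maximum, and the
  number of pairs is itself exponential in \<open>m + n\<close>.\<close>

lemma expectation_spectral_norm_sign_pattern_le:
  assumes I: "finite I" and inj: "inj_on loc I" and loc: "loc ` I \<subseteq> {..<m} \<times> {..<n}"
    and m: "m \<ge> 1" and n: "n \<ge> 1"
  shows "measure_pmf.expectation (rademacher I)
      (\<lambda>\<epsilon>. spectral_norm (Matrix.mat m n (sign_pattern I loc \<epsilon>))) \<le> 23 * (sqrt m + sqrt n)"
proof -
  define \<mu> where "\<mu> = sqrt (real m + real n)"
  \<comment> \<open>22 = 6 + 16, with 6 from the cardinalities of the lattice balls and 16 from the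
    exponential moments, so that \<open>exp (\<mu> * \<alpha>)\<close> bounds the expectation of
    \<open>S\<close>.\<close>
  define \<alpha> where "\<alpha> = 22 * \<mu>"
  \<comment> \<open>Rounding scales the form by \<open>sqrt m * sqrt n\<close>; dividing by it turns
    the exponent into \<open>\<mu>\<close> times the original form.\<close>
  define l where "l = \<mu> / (sqrt m * sqrt n)"
  define S where "S \<epsilon> = (\<Sum>z\<in>lattice_ball m. \<Sum>w\<in>lattice_ball n.
      exp (l * bilin m n (sign_pattern I loc \<epsilon>) z w))" for \<epsilon>
  have \<mu>1: "\<mu> \<ge> 1" using m by (simp add: \<mu>_def)
  have l0: "l \<ge> 0" using \<mu>1 by (simp add: l_def)
  have \<mu>2: "\<mu> * \<mu> = real m + real n" by (simp add: \<mu>_def)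
  have pointwise: "spectral_norm (Matrix.mat m n (sign_pattern I loc \<epsilon>)) \<le>
      \<alpha> + exp (- \<mu> * \<alpha>) / \<mu> * S \<epsilon>" for \<epsilon>
  proof (rule spectral_norm_leI)
    fix a b :: "nat \<Rightarrow> real"
    let ?x = "bilin m n (sign_pattern I loc \<epsilon>) a b"
    assume "L2_set a {..<m} \<le> 1" "L2_set b {..<n} \<le> 1"
    then obtain z w where zw: "z \<in> lattice_ball m" "w \<in> lattice_ball n"
      and le: "sqrt m * sqrt n * ?x \<le> bilin m n (sign_pattern I loc \<epsilon>) z w"
      using bilin_rounding by blast
    have "\<mu> * ?x = l * (sqrt m * sqrt n * ?x)" using m n by (simp add: l_def)
    also have "\<dots> \<le> l * bilin m n (sign_pattern I loc \<epsilon>) z w"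
      using le l0 by (rule mult_left_mono)
    finally have "exp (\<mu> * ?x) \<le> exp (l * bilin m n (sign_pattern I loc \<epsilon>) z w)" by simp
    also have "\<dots> \<le> (\<Sum>w\<in>lattice_ball n. exp (l * bilin m n (sign_pattern I loc \<epsilon>) z w))"
      using zw by (intro member_le_sum[of w]) auto
    also have "\<dots> \<le> S \<epsilon>"
      unfolding S_def using zw by (intro member_le_sum[of z]) (auto intro!: sum_nonneg)
    finally have "exp (- \<mu> * \<alpha>) * exp (\<mu> * ?x) \<le> exp (- \<mu> * \<alpha>) * S \<epsilon>" by simp
    \<comment> \<open>The inequality \<open>u \<le> exp u\<close> takes the place of a logarithm and
      Jensen's inequality.\<close>
    moreover have "\<mu> * (?x - \<alpha>) \<le> exp (- \<mu> * \<alpha>) * exp (\<mu> * ?x)"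
      using exp_ge_add_one_self[of "\<mu> * (?x - \<alpha>)"]
      by (simp add: algebra_simps flip: exp_add)
    ultimately have "\<mu> * (?x - \<alpha>) \<le> exp (- \<mu> * \<alpha>) * S \<epsilon>" by linarith
    then show "?x \<le> \<alpha> + exp (- \<mu> * \<alpha>) / \<mu> * S \<epsilon>"
      using \<mu>1 by (simp add: field_simps)
  qed (use n in simp)
  have term_le: "measure_pmf.expectation (rademacher I)
      (\<lambda>\<epsilon>. exp (l * bilin m n (sign_pattern I loc \<epsilon>) z w)) \<le> exp (16 * (real m + real n))"
    if z: "z \<in> lattice_ball m" and w: "w \<in> lattice_ball n" for z w
  proof -
    let ?c = "\<lambda>q. (real_of_int (z (fst q)))\<^sup>2 * (real_of_int (w (snd q)))\<^sup>2"
    have z4: "(\<Sum>i<m. (real_of_int (z i))\<^sup>2) \<le> 4 * real m"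
      using z of_int_le_iff[of "\<Sum>i<m. (z i)\<^sup>2" "4 * int m", where ?'a = real]
      unfolding lattice_ball_def by simp
    have w4: "(\<Sum>i<n. (real_of_int (w i))\<^sup>2) \<le> 4 * real n"
      using w of_int_le_iff[of "\<Sum>i<n. (w i)\<^sup>2" "4 * int n", where ?'a = real]
      unfolding lattice_ball_def by simp
    \<comment> \<open>Distinctness of the locations enters here: every matrix position is counted at
      most once, so the sum is at most a product of two squared lengths.\<close>
    have "(\<Sum>t\<in>I. ?c (loc t)) = (\<Sum>q\<in>loc ` I. ?c q)"
      using inj by (simp add: sum.reindex)
    also have "\<dots> \<le> (\<Sum>q\<in>{..<m} \<times> {..<n}. ?c q)"
      using loc by (intro sum_mono2) auto
    also have "\<dots> = (\<Sum>i<m. (real_of_int (z i))\<^sup>2) * (\<Sum>j<n. (real_of_int (w j))\<^sup>2)"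
      by (simp add: sum_product sum.cartesian_product case_prod_unfold)
    also have "\<dots> \<le> (4 * real m) * (4 * real n)"
      using z4 w4 by (intro mult_mono sum_nonneg) auto
    finally have c: "(\<Sum>t\<in>I. ?c (loc t)) \<le> 16 * (real m * real n)" by simp
    have "l * bilin m n (sign_pattern I loc \<epsilon>) z w =
        (\<Sum>t\<in>I. \<epsilon> t * (l * (real_of_int (z (fst (loc t))) * real_of_int (w (snd (loc t))))))" for \<epsilon>
      unfolding bilin_sign_pattern[OF loc] by (simp add: sum_distrib_left mult_ac)
    then have "measure_pmf.expectation (rademacher I)
        (\<lambda>\<epsilon>. exp (l * bilin m n (sign_pattern I loc \<epsilon>) z w)) \<le>
        exp (\<Sum>t\<in>I. (l * (real_of_int (z (fst (loc t))) * real_of_int (w (snd (loc t)))))\<^sup>2)"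
      using expectation_rademacher_exp_le[OF I] by simp
    also have "(\<Sum>t\<in>I. (l * (real_of_int (z (fst (loc t))) * real_of_int (w (snd (loc t)))))\<^sup>2) =
        l\<^sup>2 * (\<Sum>t\<in>I. ?c (loc t))"
      by (simp add: power_mult_distrib sum_distrib_left)
    also have "\<dots> \<le> l\<^sup>2 * (16 * (real m * real n))"
      using c by (rule mult_left_mono) simp
    also have "\<dots> = 16 * (real m + real n)"
    proof -
      have "l\<^sup>2 = (real m + real n) / (real m * real n)"
        by (simp add: l_def \<mu>_def power_divide power_mult_distrib)
      then show ?thesis using m n by simp
    qed
    finally show ?thesis by simp
  qed
  have "measure_pmf.expectation (rademacher I) S =
      (\<Sum>z\<in>lattice_ball m. \<Sum>w\<in>lattice_ball n. measure_pmf.expectation (rademacher I)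
        (\<lambda>\<epsilon>. exp (l * bilin m n (sign_pattern I loc \<epsilon>) z w)))"
    unfolding S_def using I by (simp add: Bochner_Integration.integral_sum)
  also have "\<dots> \<le> (\<Sum>z\<in>lattice_ball m. \<Sum>w\<in>lattice_ball n. exp (16 * (real m + real n)))"
    by (intro sum_mono term_le)
  also have "\<dots> = (real (card (lattice_ball m)) * real (card (lattice_ball n))) *
      exp (16 * (real m + real n))"
    by simp
  also have "\<dots> \<le> (exp (6 * real m) * exp (6 * real n)) * exp (16 * (real m + real n))"
    by (intro mult_right_mono mult_mono card_lattice_ball_le) auto
  also have "\<dots> = exp (\<mu> * \<alpha>)"
    using \<mu>2 by (simp add: \<alpha>_def algebra_simps flip: exp_add)
  finally have ES: "measure_pmf.expectation (rademacher I) S \<le> exp (\<mu> * \<alpha>)" .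
  have "measure_pmf.expectation (rademacher I)
      (\<lambda>\<epsilon>. spectral_norm (Matrix.mat m n (sign_pattern I loc \<epsilon>))) \<le>
      measure_pmf.expectation (rademacher I) (\<lambda>\<epsilon>. \<alpha> + exp (- \<mu> * \<alpha>) / \<mu> * S \<epsilon>)"
    by (rule expectation_rademacher_mono[OF I pointwise])
  also have "\<dots> = \<alpha> + exp (- \<mu> * \<alpha>) / \<mu> * measure_pmf.expectation (rademacher I) S"
    using I by (simp add: Bochner_Integration.integral_add)
  also have "\<dots> \<le> \<alpha> + exp (- \<mu> * \<alpha>) / \<mu> * exp (\<mu> * \<alpha>)"
    using ES \<mu>1 by (intro add_left_mono mult_left_mono) auto
  also have "\<dots> = \<alpha> + 1 / \<mu>" by (simp flip: exp_add)
  also have "\<dots> \<le> 23 * \<mu>"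
  proof -
    have "1 / \<mu> \<le> \<mu>" using \<mu>1 by (simp add: divide_le_eq) (metis mult_mono' mult_1 zero_le_one)
    then show ?thesis by (simp add: \<alpha>_def)
  qed
  also have "\<mu> \<le> sqrt m + sqrt n"
    unfolding \<mu>_def by (rule sqrt_add_le_add_sqrt) auto
  finally show ?thesis by simp
qed

subsection \<open>The regret bound\<close>

text \<open>Conditioning on the sign at \<open>t\<close>; this isolates one fresh sign in the
  potential.\<close>

lemma expectation_rademacher_insert:
  fixes h :: "(nat \<Rightarrow> real) \<Rightarrow> real"
  assumes "finite A" "t \<notin> A"
  shows "measure_pmf.expectation (rademacher (insert t A)) h =
      (measure_pmf.expectation (rademacher A) (\<lambda>\<epsilon>. h (\<epsilon>(t := 1))) +
       measure_pmf.expectation (rademacher A) (\<lambda>\<epsilon>. h (\<epsilon>(t := -1)))) / 2"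
proof -
  have "rademacher (insert t A) =
      pmf_of_set {-1, 1} \<bind> (\<lambda>e. map_pmf (\<lambda>\<epsilon>. \<epsilon>(t := e)) (rademacher A))"
    unfolding rademacher_def Pi_pmf_insert'[OF assms] map_pmf_def ..
  then have "measure_pmf.expectation (rademacher (insert t A)) h =
      (\<Sum>e\<in>{-1, 1}. pmf (pmf_of_set {-1, 1}) e *\<^sub>R
        measure_pmf.expectation (map_pmf (\<lambda>\<epsilon>. \<epsilon>(t := e)) (rademacher A)) h)"
    using assms by (simp only:) (rule pmf_expectation_bind, auto)
  then show ?thesis by (simp add: field_simps)
qed

lemma spectral_norm_line_convex:
  fixes F X :: "nat \<times> nat \<Rightarrow> real"
  assumes n: "n > 0" and p: "p \<ge> 0" "r \<ge> 0" "p + r = 1"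
  shows "spectral_norm (Matrix.mat m n (\<lambda>q. F q + (p * a + r * b) * X q)) \<le>
      p * spectral_norm (Matrix.mat m n (\<lambda>q. F q + a * X q)) +
      r * spectral_norm (Matrix.mat m n (\<lambda>q. F q + b * X q))"
proof -
  have "F q + (p * a + r * b) * X q = p * (F q + a * X q) + r * (F q + b * X q)" for q
  proof -
    have "F q = (p + r) * F q" using p by simp
    then show ?thesis by (simp add: algebra_simps)
  qed
  then show ?thesis
    using spectral_norm_lincomb_le[OF n p(1,2), of m "\<lambda>q. F q + a * X q" "\<lambda>q. F q + b * X q"]
    by simp
qed

text \<open>
  The left-hand side is convex in \<open>s\<close>, and at \<open>s = 1/2\<close> and \<open>s = - 1/2\<close> it equals the average of
  \<open>N (1/2)\<close> and \<open>N (- 1/2)\<close>.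
\<close>

lemma spectral_norm_random_sign_step:
  fixes F X :: "nat \<times> nat \<Rightarrow> real" and m :: nat
  assumes n: "n > 0" and s: "\<bar>s\<bar> \<le> 1/2"
  defines "N \<equiv> \<lambda>c. spectral_norm (Matrix.mat m n (\<lambda>q. F q + c * X q))"
  shows "s * (N (1/2) - N (- 1/2)) + N (- s) \<le> (N 1 + N (- 1)) / 2"
proof -
  have conv: "N (p * a + r * b) \<le> p * N a + r * N b" if "p \<ge> 0" "r \<ge> 0" "p + r = 1" for p r a b
    unfolding N_def by (rule spectral_norm_line_convex[OF n that])
  have "N (- s) \<le> (1/2 + s) * N (- 1/2) + (1/2 - s) * N (1/2)"
    using conv[of "1/2 + s" "1/2 - s" "- 1/2" "1/2"] s by (simp add: algebra_simps)
  \<comment> \<open>The points \<open>1/2\<close> and \<open>- 1/2\<close> are mixtures of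
    \<open>1\<close> and \<open>- 1\<close> with mirrored weights, so the two bounds add up to
    \<open>N 1 + N (- 1)\<close>.\<close>
  moreover have "N (1/2) \<le> 3/4 * N 1 + 1/4 * N (- 1)"
    using conv[of "3/4" "1/4" 1 "- 1"] by simp
  moreover have "N (- 1/2) \<le> 1/4 * N 1 + 3/4 * N (- 1)"
    using conv[of "1/4" "3/4" 1 "- 1"] by simp
  ultimately show ?thesis by (simp add: algebra_simps)
qed

text \<open>One unit away in the direction \<open>sgn s\<close>, the subgradient inequality forces
  \<open>f\<close> to grow by at least \<open>\<bar>s\<bar>\<close>.\<close>

lemma abs_subgradient_le_lipschitz:
  assumes lip: "\<rho>-lipschitz_on UNIV f" and sub: "is_subgradient f u s"
  shows "\<bar>s\<bar> \<le> \<rho>"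
proof -
  have "\<bar>f (u + sgn s) - f u\<bar> \<le> \<rho> * \<bar>sgn s\<bar>"
    using lipschitz_onD[OF lip, of "u + sgn s" u] by (simp add: dist_real_def)
  moreover have "f (u + sgn s) \<ge> f u + \<bar>s\<bar>"
    using sub unfolding is_subgradient_def by (metis abs_sgn add_diff_cancel_left')
  moreover have "\<rho> \<ge> 0" using lip by (rule lipschitz_on_nonneg)
  ultimately show ?thesis by (cases "s = 0") (auto simp: sgn_if split: if_splits)
qed

section \<open>The comparator class and the potential\<close>

lemma mat_inner_mat:
  assumes "f \<in> carrier_mat m n"
  shows "mat_inner f (Matrix.mat m n F) = (\<Sum>j<n. \<Sum>i<m. f $$ (i, j) * F (i, j))"
  using assms unfolding mat_inner_def
  by (auto simp: scalar_prod_def lessThan_atLeast0 intro!: sum.cong)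

text \<open>Puts the zero matrix into the comparator class, so that the infimum in the regret is
  over a nonempty set. Only 0 can be an eigenvalue.\<close>

lemma trace_norm_zero: "trace_norm (0\<^sub>m m n) = 0"
proof -
  have "sqrt z = 0" if z: "z \<in> spectrum (0\<^sub>m n n :: real mat)" for z
  proof -
    obtain v where "eigenvector (0\<^sub>m n n) v z"
      using z unfolding spectrum_def eigenvalue_def by auto
    then have v: "v \<in> carrier_vec n" "v \<noteq> 0\<^sub>v n" "0\<^sub>m n n *\<^sub>v v = z \<cdot>\<^sub>v v"
      unfolding eigenvector_def by simp_all
    then obtain i where i: "i < n" "v $ i \<noteq> 0"
      by (metis carrier_vecD eq_vecI index_zero_vec)
    have "0 = (0\<^sub>m n n *\<^sub>v v) $ i" using v(1) i(1) by (simp add: scalar_prod_def)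
    also have "\<dots> = z * v $ i" unfolding v(3) using v(1) i(1) by simp
    finally show ?thesis using i(2) by simp
  qed
  then show ?thesis unfolding trace_norm_def by simp
qed

text \<open>
  Past outcomes enter through their subgradients and future ones through random signs; the expected
  spectral norm of this matrix is the potential of the regret analysis.
\<close>

definition mixed_sum :: "nat \<Rightarrow> (nat \<Rightarrow> real mat) \<Rightarrow> real \<Rightarrow> (nat \<Rightarrow> real) \<Rightarrow> nat \<Rightarrow>
    (nat \<Rightarrow> real) \<Rightarrow> nat \<times> nat \<Rightarrow> real" where
  "mixed_sum T x \<rho> g t \<epsilon> q =
     (\<Sum>i=t+1..T. \<epsilon> i * x i $$ q) - 1 / (2 * \<rho>) * (\<Sum>i=1..t. g i * x i $$ q)"

definition potential :: "nat \<Rightarrow> nat \<Rightarrow> nat \<Rightarrow> (nat \<Rightarrow> real mat) \<Rightarrow> real \<Rightarrow> (nat \<Rightarrow> real) \<Rightarrow> nat \<Rightarrow> real" where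
  "potential m n T x \<rho> g t = measure_pmf.expectation (rademacher {t+1..T})
     (\<lambda>\<epsilon>. spectral_norm (Matrix.mat m n (mixed_sum T x \<rho> g t \<epsilon>)))"

text \<open>The two potentials differ only in the coefficient of \<open>x (Suc t)\<close>: a fresh
  random sign before the round, \<open>- s\<close> after it. The prediction is the matching
  difference of norms, so the one-step inequality applies for each choice of the later
  signs.\<close>

lemma potential_step:
  assumes n: "n > 0" and \<rho>: "\<rho> > 0" and B: "B \<ge> 0" and t: "t < T"
    and x: "x (Suc t) \<in> carrier_mat m n" and g: "\<bar>g (Suc t)\<bar> \<le> \<rho>"
  shows "g (Suc t) * prediction m n T x B \<rho> g (Suc t) + 2 * \<rho> * B * potential m n T x \<rho> g (Suc t) \<le>
      2 * \<rho> * B * potential m n T x \<rho> g t"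
proof -
  \<comment> \<open>Round \<open>Suc t\<close> is absent from both sums of \<open>F\<close> below:
    later rounds carry signs, earlier ones subgradients.\<close>
  define I where "I = {Suc t + 1..T}"
  define F where "F \<epsilon> q = (\<Sum>i\<in>I. \<epsilon> i * x i $$ q) - 1 / (2 * \<rho>) * (\<Sum>i=1..t. g i * x i $$ q)"
    for \<epsilon> q
  define N where "N \<epsilon> c = spectral_norm (Matrix.mat m n (\<lambda>q. F \<epsilon> q + c * x (Suc t) $$ q))" for \<epsilon> c
  define s where "s = g (Suc t) / (2 * \<rho>)"
  let ?E = "measure_pmf.expectation (rademacher I)"
  have I: "finite I" "Suc t \<notin> I" "{t + 1..T} = insert (Suc t) I"
    using t by (auto simp: I_def)
  \<comment> \<open>The scaling by \<open>2 * \<rho>\<close> brings \<open>s\<close> into the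
    interval between the two points used by the prediction.\<close>
  have s: "\<bar>s\<bar> \<le> 1/2" using g \<rho> by (simp add: s_def abs_divide field_simps)
  have pred: "prediction m n T x B \<rho> g (Suc t) = B * ?E (\<lambda>\<epsilon>. N \<epsilon> (1/2) - N \<epsilon> (- 1/2))"
  proof -
    have Mx: "x (Suc t) = Matrix.mat m n (\<lambda>q. x (Suc t) $$ q)"
      using x by (intro eq_matI) auto
    have "mat_lincomb m n I \<epsilon> x - (1 / (2 * \<rho>)) \<cdot>\<^sub>m mat_lincomb m n {1..<Suc t} g x
        + (1/2) \<cdot>\<^sub>m x (Suc t) = Matrix.mat m n (\<lambda>q. F \<epsilon> q + (1/2) * x (Suc t) $$ q)" for \<epsilon>
      using x unfolding mat_lincomb_def F_def
      by (intro eq_matI) (auto simp: atLeastLessThanSuc_atLeastAtMost)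
    moreover have "mat_lincomb m n I \<epsilon> x - (1 / (2 * \<rho>)) \<cdot>\<^sub>m mat_lincomb m n {1..<Suc t} g x
        - (1/2) \<cdot>\<^sub>m x (Suc t) = Matrix.mat m n (\<lambda>q. F \<epsilon> q + (- 1/2) * x (Suc t) $$ q)" for \<epsilon>
      using x unfolding mat_lincomb_def F_def
      by (intro eq_matI) (auto simp: atLeastLessThanSuc_atLeastAtMost)
    ultimately show ?thesis
      unfolding prediction_def Let_def N_def I_def by simp
  qed
  have "mixed_sum T x \<rho> g (Suc t) \<epsilon> = (\<lambda>q. F \<epsilon> q + (- s) * x (Suc t) $$ q)" for \<epsilon>
    by (rule ext) (simp add: mixed_sum_def F_def I_def s_def add_divide_distrib algebra_simps)
  then have pot1: "potential m n T x \<rho> g (Suc t) = ?E (\<lambda>\<epsilon>. N \<epsilon> (- s))"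
    unfolding potential_def N_def I_def by simp
  have "mixed_sum T x \<rho> g t (\<epsilon>(Suc t := e)) = (\<lambda>q. F \<epsilon> q + e * x (Suc t) $$ q)" for \<epsilon> e
  proof (rule ext)
    fix q
    have "(\<Sum>i\<in>I. (\<epsilon>(Suc t := e)) i * x i $$ q) = (\<Sum>i\<in>I. \<epsilon> i * x i $$ q)"
      using I(2) by (intro sum.cong) auto
    then show "mixed_sum T x \<rho> g t (\<epsilon>(Suc t := e)) q = F \<epsilon> q + e * x (Suc t) $$ q"
      unfolding mixed_sum_def I(3) F_def using I(1,2) by simp
  qed
  then have pot0: "potential m n T x \<rho> g t = (?E (\<lambda>\<epsilon>. N \<epsilon> 1) + ?E (\<lambda>\<epsilon>. N \<epsilon> (- 1))) / 2"
    unfolding potential_def I(3) expectation_rademacher_insert[OF I(1,2)] N_def by simp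
  have "s * ?E (\<lambda>\<epsilon>. N \<epsilon> (1/2) - N \<epsilon> (- 1/2)) + ?E (\<lambda>\<epsilon>. N \<epsilon> (- s)) =
      ?E (\<lambda>\<epsilon>. s * (N \<epsilon> (1/2) - N \<epsilon> (- 1/2)) + N \<epsilon> (- s))"
    using I(1) by (simp add: Bochner_Integration.integral_add)
  also have "\<dots> \<le> ?E (\<lambda>\<epsilon>. (N \<epsilon> 1 + N \<epsilon> (- 1)) / 2)"
    unfolding N_def
    by (intro expectation_rademacher_mono[OF I(1)] spectral_norm_random_sign_step[OF n s])
  also have "\<dots> = potential m n T x \<rho> g t"
    unfolding pot0 using I(1) by (simp add: Bochner_Integration.integral_add)
  finally have "2 * \<rho> * B * (s * ?E (\<lambda>\<epsilon>. N \<epsilon> (1/2) - N \<epsilon> (- 1/2)) + ?E (\<lambda>\<epsilon>. N \<epsilon> (- s))) \<le>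
      2 * \<rho> * B * potential m n T x \<rho> g t"
    using \<rho> B by (intro mult_left_mono) auto
  moreover have "2 * \<rho> * s = g (Suc t)" using \<rho> by (simp add: s_def)
  then have gB: "g (Suc t) * (B * e) = 2 * \<rho> * B * (s * e)" for e
    by (metis mult.assoc mult.commute)
  ultimately show ?thesis
    unfolding pred pot1 gB by (simp only: distrib_left)
qed

text \<open>Telescoping of \<open>potential_step\<close>. The horizon \<open>T\<close> stays fixed,
  and the induction runs over an intermediate round \<open>k\<close>.\<close>

lemma sum_predictions_le_potential:
  assumes n: "n > 0" and \<rho>: "\<rho> > 0" and B: "B \<ge> 0"
    and x: "\<And>t. t \<in> {1..T} \<Longrightarrow> x t \<in> carrier_mat m n"
    and g: "\<And>t. t \<in> {1..T} \<Longrightarrow> \<bar>g t\<bar> \<le> \<rho>"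
  shows "(\<Sum>t=1..T. g t * prediction m n T x B \<rho> g t) + 2 * \<rho> * B * potential m n T x \<rho> g T \<le>
      2 * \<rho> * B * potential m n T x \<rho> g 0"
proof -
  have "(\<Sum>t=1..k. g t * prediction m n T x B \<rho> g t) + 2 * \<rho> * B * potential m n T x \<rho> g k \<le>
      2 * \<rho> * B * potential m n T x \<rho> g 0" if "k \<le> T" for k
    using that
  proof (induction k)
    case (Suc k)
    then have "g (Suc k) * prediction m n T x B \<rho> g (Suc k) + 2 * \<rho> * B * potential m n T x \<rho> g (Suc k) \<le>
        2 * \<rho> * B * potential m n T x \<rho> g k"
      using x[of "Suc k"] g[of "Suc k"] by (intro potential_step n \<rho> B) auto
    then show ?case using Suc by simp
  qed simp
  then show ?thesis by simp
qed

text \<open>At time 0 no subgradient has entered, and the matrix is a pure random sign pattern in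
  distinct positions.\<close>

lemma potential_0_le:
  assumes m: "m \<ge> 1" and n: "n \<ge> 1"
    and loc: "\<And>t. t \<in> {1..T} \<Longrightarrow> loc t \<in> {..<m} \<times> {..<n}" and inj: "inj_on loc {1..T}"
    and x: "\<And>t. t \<in> {1..T} \<Longrightarrow> x t = entry_mat m n (loc t)"
  shows "potential m n T x \<rho> g 0 \<le> 23 * (sqrt m + sqrt n)"
proof -
  have "Matrix.mat m n (mixed_sum T x \<rho> g 0 \<epsilon>) = Matrix.mat m n (sign_pattern {1..T} loc \<epsilon>)" for \<epsilon>
  proof (rule eq_matI)
    fix i j
    assume ij: "i < dim_row (Matrix.mat m n (sign_pattern {1..T} loc \<epsilon>))"
      "j < dim_col (Matrix.mat m n (sign_pattern {1..T} loc \<epsilon>))"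
    have "(\<Sum>t=1..T. \<epsilon> t * x t $$ (i, j)) = sign_pattern {1..T} loc \<epsilon> (i, j)"
      unfolding sign_pattern_def
      by (intro sum.cong refl) (use ij in \<open>auto simp: x entry_mat_def\<close>)
    then show "Matrix.mat m n (mixed_sum T x \<rho> g 0 \<epsilon>) $$ (i, j) =
        Matrix.mat m n (sign_pattern {1..T} loc \<epsilon>) $$ (i, j)"
      using ij by (simp add: mixed_sum_def)
  qed auto
  moreover have "loc ` {1..T} \<subseteq> {..<m} \<times> {..<n}" using loc by blast
  ultimately show ?thesis
    using expectation_spectral_norm_sign_pattern_le[OF _ inj _ m n]
    unfolding potential_def by simp
qed

text \<open>At time \<open>T\<close> no signs remain, so the potential is the spectral norm of the
  scaled sum of subgradients, and trace duality applies to it.\<close>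

lemma comparator_le_potential:
  assumes n: "n > 0" and \<rho>: "\<rho> > 0" and f: "f \<in> carrier_mat m n" and fB: "trace_norm f \<le> B"
    and x: "\<And>t. t \<in> {1..T} \<Longrightarrow> x t \<in> carrier_mat m n"
  shows "- (\<Sum>t=1..T. g t * mat_inner f (x t)) \<le> 2 * \<rho> * B * potential m n T x \<rho> g T"
proof -
  let ?S = "Matrix.mat m n (\<lambda>q. - 1 / (2 * \<rho>) * (\<Sum>t=1..T. g t * x t $$ q))"
  have "mixed_sum T x \<rho> g T \<epsilon> = (\<lambda>q. - 1 / (2 * \<rho>) * (\<Sum>t=1..T. g t * x t $$ q))" for \<epsilon>
    by (simp add: mixed_sum_def fun_eq_iff)
  then have S: "spectral_norm ?S = potential m n T x \<rho> g T"
    unfolding potential_def by simp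
  have "mat_inner f (x t) = (\<Sum>j<n. \<Sum>i<m. f $$ (i, j) * x t $$ (i, j))" if "t \<in> {1..T}" for t
  proof -
    have "Matrix.mat m n (\<lambda>q. x t $$ q) = x t" using x[OF that] by (intro eq_matI) auto
    then show ?thesis using mat_inner_mat[OF f, of "\<lambda>q. x t $$ q"] by simp
  qed
  then have "- (\<Sum>t=1..T. g t * mat_inner f (x t)) =
      - (\<Sum>t=1..T. \<Sum>j<n. \<Sum>i<m. f $$ (i, j) * (g t * x t $$ (i, j)))"
    by (simp add: sum_distrib_left mult_ac)
  also have "\<dots> = - (\<Sum>j<n. \<Sum>i<m. \<Sum>t=1..T. f $$ (i, j) * (g t * x t $$ (i, j)))"
    by (subst sum.swap) (intro arg_cong[where f = uminus] sum.cong refl sum.swap)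
  also have "\<dots> = 2 * \<rho> * mat_inner f ?S"
    using \<rho> by (simp add: mat_inner_mat[OF f] sum_distrib_left sum_negf)
  also have "\<dots> \<le> 2 * \<rho> * (trace_norm f * spectral_norm ?S)"
    using \<rho> by (intro mult_left_mono mat_inner_le_trace_norm_spectral_norm[OF f]) auto
  also have "\<dots> \<le> 2 * \<rho> * (B * spectral_norm ?S)"
    using \<rho> fB n by (intro mult_left_mono mult_right_mono spectral_norm_nonneg) auto
  also have "spectral_norm ?S = potential m n T x \<rho> g T" by (rule S)
  finally show ?thesis by (simp add: mult.assoc)
qed

theorem corollary22:
  shows "\<exists>C::real. \<forall>(m::nat) (n::nat) (T::nat) (loc :: nat \<Rightarrow> nat \<times> nat) (x :: nat \<Rightarrow> real mat)
           (B::real) (\<rho>::real) (Y :: real set) (loss :: real \<Rightarrow> real \<Rightarrow> real)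
           (y :: nat \<Rightarrow> real) (yhat :: nat \<Rightarrow> real) (g :: nat \<Rightarrow> real).
         m \<ge> 1 \<longrightarrow> n \<ge> 1 \<longrightarrow> B \<ge> 0 \<longrightarrow> \<rho> > 0 \<longrightarrow>
         (\<forall>t\<in>{1..T}. loc t \<in> {..<m} \<times> {..<n}) \<longrightarrow>
         inj_on loc {1..T} \<longrightarrow>
         (\<forall>t\<in>{1..T}. x t = entry_mat m n (loc t)) \<longrightarrow>
         (\<forall>z\<in>Y. convex_on UNIV (\<lambda>v. loss v z) \<and> \<rho>-lipschitz_on UNIV (\<lambda>v. loss v z)) \<longrightarrow>
         (\<forall>t\<in>{1..T}. y t \<in> Y) \<longrightarrow>
         (\<forall>t\<in>{1..T}. is_subgradient (\<lambda>v. loss v (y t)) (yhat t) (g t)) \<longrightarrow>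
         (\<forall>t\<in>{1..T}. yhat t = prediction m n T x B \<rho> g t) \<longrightarrow>
         regret m n T x B loss yhat y \<le> C * (B * \<rho> * (sqrt (real m) + sqrt (real n)))"
proof (intro exI[of _ 46] allI impI, goal_cases)
  case (1 m n T loc x B \<rho> Y loss y yhat g)
  then have m: "m \<ge> 1" and n: "n \<ge> 1" and B: "B \<ge> 0" and \<rho>: "\<rho> > 0"
    and loc: "\<And>t. t \<in> {1..T} \<Longrightarrow> loc t \<in> {..<m} \<times> {..<n}" and inj: "inj_on loc {1..T}"
    and x: "\<And>t. t \<in> {1..T} \<Longrightarrow> x t = entry_mat m n (loc t)"
    and lip: "\<And>t. t \<in> {1..T} \<Longrightarrow> \<rho>-lipschitz_on UNIV (\<lambda>v. loss v (y t))"
    and sub: "\<And>t. t \<in> {1..T} \<Longrightarrow> is_subgradient (\<lambda>v. loss v (y t)) (yhat t) (g t)"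
    and yhat: "\<And>t. t \<in> {1..T} \<Longrightarrow> yhat t = prediction m n T x B \<rho> g t"
    by auto
  have n0: "n > 0" using n by simp
  have xc: "x t \<in> carrier_mat m n" if "t \<in> {1..T}" for t
    using x[OF that] by (simp add: entry_mat_def)
  have g: "\<bar>g t\<bar> \<le> \<rho>" if "t \<in> {1..T}" for t
    using abs_subgradient_le_lipschitz[OF lip sub] that by blast
  \<comment> \<open>46 = 2 * 23, from the factor \<open>2 * \<rho> * B\<close> of the potential and
    the constant of \<open>potential_0_le\<close>.\<close>
  define R where "R = 46 * (B * \<rho> * (sqrt (real m) + sqrt (real n)))"
  have "2 * \<rho> * B * potential m n T x \<rho> g 0 \<le> 2 * \<rho> * B * (23 * (sqrt m + sqrt n))"
    using \<rho> B by (intro mult_left_mono potential_0_le[OF m n loc inj x]) auto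
  then have R: "(\<Sum>t=1..T. g t * yhat t) + 2 * \<rho> * B * potential m n T x \<rho> g T \<le> R"
    using sum_predictions_le_potential[OF n0 \<rho> B, of T x m g] xc g
    by (simp add: R_def yhat algebra_simps)
  \<comment> \<open>A lower bound valid for every comparator passes to the infimum because the class
    is nonempty.\<close>
  have "(\<Sum>t=1..T. loss (yhat t) (y t)) - R \<le>
      (INF f\<in>{f \<in> carrier_mat m n. trace_norm f \<le> B}. \<Sum>t=1..T. loss (mat_inner f (x t)) (y t))"
  proof (rule cINF_greatest)
    have "0\<^sub>m m n \<in> {f \<in> carrier_mat m n. trace_norm f \<le> B}"
      using B by (simp add: trace_norm_zero)
    then show "{f \<in> carrier_mat m n. trace_norm f \<le> B} \<noteq> {}" by blast
  next
    fix f assume "f \<in> {f \<in> carrier_mat m n. trace_norm f \<le> B}"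
    then have f: "f \<in> carrier_mat m n" "trace_norm f \<le> B" by auto
    \<comment> \<open>The subgradient inequality in each round replaces the comparator's loss by a
      linear lower bound.\<close>
    have "(\<Sum>t=1..T. loss (yhat t) (y t) + g t * (mat_inner f (x t) - yhat t)) \<le>
        (\<Sum>t=1..T. loss (mat_inner f (x t)) (y t))"
      using sub unfolding is_subgradient_def by (intro sum_mono) simp
    moreover have "- (\<Sum>t=1..T. g t * mat_inner f (x t)) \<le> 2 * \<rho> * B * potential m n T x \<rho> g T"
      using xc by (intro comparator_le_potential[OF n0 \<rho> f]) auto
    ultimately show "(\<Sum>t=1..T. loss (yhat t) (y t)) - R \<le> (\<Sum>t=1..T. loss (mat_inner f (x t)) (y t))"
      using R by (simp add: sum.distrib right_diff_distrib sum_subtractf)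
  qed
  then show ?case unfolding regret_def R_def by simp
qed

end
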